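(* The two subgroups $SL(\mathbb{H}^+)$ and $Sp(1,1)$ of $SL(2,\mathbb{H})$ are isomorphic.
   Context: $\mathbb{H}$ is the skew field of real quaternions. For a $2\times2$ quaternionic matrix $A=\begin{bmatrix} a & b\\ c & d\end{bmatrix}$, $\det_{\mathbb{H}}(A)=\sqrt{|a|^2|d|^2+|c|^2|b|^2-2\,\mathrm{Re}(c\,\overline{a}\,b\,\overline{d})}$; $GL(2,\mathbb{H})$ is the group of such matrices with $\det_{\mathbb{H}}(A)\neq 0$ (equivalently, invertible), $SL(2,\mathbb{H})$ the subgroup with $\det_{\mathbb{H}}(A)=1$. With $K=\begin{bmatrix} 0&1\\1&0\end{bmatrix}$ and $H=\begin{bmatrix} 1&0\\0&-1\end{bmatrix}$, and ${}^t\overline{A}$ the conjugate transpose, $SL(\mathbb{H}^+)=\{A\in GL(2,\mathbb{H}):{}^t\overline{A}KA=K\}$ and $Sp(1,1)=\{A\in GL(2,\mathbb{H}):{}^t\overline{A}HA=H\}$. *)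

theory Defs
  imports "HOL-Analysis.Analysis" "HOL-Algebra.Group"
begin

text \<open>
  The quaternion \<open>a + b i + c j + d k\<close> is \<open>Quat a b c d\<close>. The class instances follow those of
  \<^typ>\<open>complex\<close> in \<^theory>\<open>HOL.Complex\<close>; the multiplication is the one with
  \<open>i\<^sup>2 = j\<^sup>2 = k\<^sup>2 = i j k = -1\<close>.
\<close>

datatype quat = Quat (qRe: real) (qI: real) (qJ: real) (qK: real)

lemma quat_eq_iff: "x = y \<longleftrightarrow> qRe x = qRe y \<and> qI x = qI y \<and> qJ x = qJ y \<and> qK x = qK y"
  by (cases x; cases y) simp

lemma quat_sum_squares_eq_0_iff:
  "(qRe x)\<^sup>2 + (qI x)\<^sup>2 + (qJ x)\<^sup>2 + (qK x)\<^sup>2 = 0 \<longleftrightarrow>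
   qRe x = 0 \<and> qI x = 0 \<and> qJ x = 0 \<and> qK x = 0"
  by (simp add: add_nonneg_eq_0_iff)

instantiation quat :: ab_group_add
begin

definition "0 = Quat 0 0 0 0"
definition "x + y = Quat (qRe x + qRe y) (qI x + qI y) (qJ x + qJ y) (qK x + qK y)" for x y :: quat
definition "- x = Quat (- qRe x) (- qI x) (- qJ x) (- qK x)" for x :: quat
definition "x - y = Quat (qRe x - qRe y) (qI x - qI y) (qJ x - qJ y) (qK x - qK y)" for x y :: quat

instance
  by standard (simp_all add: zero_quat_def plus_quat_def uminus_quat_def minus_quat_def)

end

lemma quat_zero_sel [simp]: "qRe 0 = 0" "qI 0 = 0" "qJ 0 = 0" "qK 0 = 0"
  by (simp_all add: zero_quat_def)

lemma quat_plus_sel [simp]: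
  "qRe (x + y) = qRe x + qRe y" "qI (x + y) = qI x + qI y"
  "qJ (x + y) = qJ x + qJ y" "qK (x + y) = qK x + qK y"
  by (simp_all add: plus_quat_def)

lemma quat_uminus_sel [simp]:
  "qRe (- x) = - qRe x" "qI (- x) = - qI x" "qJ (- x) = - qJ x" "qK (- x) = - qK x"
  by (simp_all add: uminus_quat_def)

lemma quat_minus_sel [simp]:
  "qRe (x - y) = qRe x - qRe y" "qI (x - y) = qI x - qI y"
  "qJ (x - y) = qJ x - qJ y" "qK (x - y) = qK x - qK y"
  by (simp_all add: minus_quat_def)

instantiation quat :: "{one, times, inverse, scaleR, norm}"
begin

definition "1 = Quat 1 0 0 0"

definition "x * y = Quat
  (qRe x * qRe y - qI x * qI y - qJ x * qJ y - qK x * qK y)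
  (qRe x * qI y + qI x * qRe y + qJ x * qK y - qK x * qJ y)
  (qRe x * qJ y - qI x * qK y + qJ x * qRe y + qK x * qI y)
  (qRe x * qK y + qI x * qJ y - qJ x * qI y + qK x * qRe y)" for x y :: quat

definition "scaleR r x = Quat (r * qRe x) (r * qI x) (r * qJ x) (r * qK x)" for x :: quat

definition "norm x = sqrt ((qRe x)\<^sup>2 + (qI x)\<^sup>2 + (qJ x)\<^sup>2 + (qK x)\<^sup>2)"

definition "inverse x =
  (let n = (qRe x)\<^sup>2 + (qI x)\<^sup>2 + (qJ x)\<^sup>2 + (qK x)\<^sup>2
   in Quat (qRe x / n) (- qI x / n) (- qJ x / n) (- qK x / n))"

definition "x div y = x * inverse y" for x y :: quat

instance ..

end

lemma quat_one_sel [simp]: "qRe 1 = 1" "qI 1 = 0" "qJ 1 = 0" "qK 1 = 0"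
  by (simp_all add: one_quat_def)

lemma quat_mult_sel [simp]:
  "qRe (x * y) = qRe x * qRe y - qI x * qI y - qJ x * qJ y - qK x * qK y"
  "qI (x * y) = qRe x * qI y + qI x * qRe y + qJ x * qK y - qK x * qJ y"
  "qJ (x * y) = qRe x * qJ y - qI x * qK y + qJ x * qRe y + qK x * qI y"
  "qK (x * y) = qRe x * qK y + qI x * qJ y - qJ x * qI y + qK x * qRe y"
  by (simp_all add: times_quat_def)

lemma quat_scaleR_sel [simp]:
  "qRe (scaleR r x) = r * qRe x" "qI (scaleR r x) = r * qI x"
  "qJ (scaleR r x) = r * qJ x" "qK (scaleR r x) = r * qK x"
  by (simp_all add: scaleR_quat_def)

instance quat :: ring_1
  by standard (simp_all add: quat_eq_iff algebra_simps)

instance quat :: division_ring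
proof
  fix x y :: quat
  show "x / y = x * inverse y"
    by (simp add: divide_quat_def)
  show "inverse (0 :: quat) = 0"
    by (simp add: inverse_quat_def quat_eq_iff)
  define n where "n = (qRe x)\<^sup>2 + (qI x)\<^sup>2 + (qJ x)\<^sup>2 + (qK x)\<^sup>2"
  assume "x \<noteq> 0"
  then have n: "n \<noteq> 0"
    unfolding n_def quat_sum_squares_eq_0_iff by (simp add: quat_eq_iff)
  have inv: "inverse x = Quat (qRe x / n) (- qI x / n) (- qJ x / n) (- qK x / n)"
    by (simp add: inverse_quat_def n_def Let_def)
  have sq: "qRe x * qRe x + qI x * qI x + qJ x * qJ x + qK x * qK x = n"
    by (simp add: n_def power2_eq_square)
  show "inverse x * x = 1" "x * inverse x = 1"
    using n sq by (simp_all add: inv quat_eq_iff mult.commute add_divide_distrib [symmetric]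
        diff_divide_distrib [symmetric])
qed

instance quat :: real_div_algebra
  by standard (simp_all add: quat_eq_iff algebra_simps)

instantiation quat :: real_normed_div_algebra
begin

definition "sgn x = x /\<^sub>R norm x" for x :: quat

definition "dist x y = norm (x - y)" for x y :: quat

definition [code del]:
  "(uniformity :: (quat \<times> quat) filter) = (INF e\<in>{0 <..}. principal {(x, y). dist x y < e})"

definition [code del]:
  "open (U :: quat set) \<longleftrightarrow> (\<forall>x\<in>U. eventually (\<lambda>(x', y). x' = x \<longrightarrow> y \<in> U) uniformity)"

instance
proof
  fix r :: real and x y :: quat
  have norm_tuple: "norm z = norm ((qRe z, qI z), (qJ z, qK z))" for z :: quat
    by (simp add: norm_quat_def norm_Pair add.assoc)
  show "norm x = 0 \<longleftrightarrow> x = 0"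
    by (simp add: norm_quat_def quat_sum_squares_eq_0_iff quat_eq_iff)
  show "norm (x + y) \<le> norm x + norm y"
    using norm_triangle_ineq[of "((qRe x, qI x), (qJ x, qK x))" "((qRe y, qI y), (qJ y, qK y))"]
    by (simp add: norm_tuple)
  show "norm (scaleR r x) = \<bar>r\<bar> * norm x"
    by (simp add: norm_quat_def power_mult_distrib distrib_left [symmetric] real_sqrt_mult)
  show "norm (x * y) = norm x * norm y"
    by (simp add: norm_quat_def real_sqrt_mult [symmetric] power2_eq_square algebra_simps)
qed (rule sgn_quat_def dist_quat_def uniformity_quat_def open_quat_def)+

end

definition qcnj :: "quat \<Rightarrow> quat" where
  "qcnj x = Quat (qRe x) (- qI x) (- qJ x) (- qK x)"

type_synonym qmat2 = "quat ^ 2 ^ 2"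

definition conj_transpose :: "qmat2 \<Rightarrow> qmat2" where
  "conj_transpose A = transpose (map_matrix qcnj A)"

text \<open>
  The library determinant \<^const>\<open>det\<close> needs commutative entries. Below, \<open>A $ i $ j\<close> is the entry in
  row \<open>i\<close> and column \<open>j\<close>.
\<close>

definition qdet :: "qmat2 \<Rightarrow> real" where
  "qdet A =
    (let a = A $ 1 $ 1; b = A $ 1 $ 2; c = A $ 2 $ 1; d = A $ 2 $ 2
     in sqrt ((norm a)\<^sup>2 * (norm d)\<^sup>2 + (norm c)\<^sup>2 * (norm b)\<^sup>2
              - 2 * qRe (c * qcnj a * b * qcnj d)))"

definition GL2H :: "qmat2 monoid" where
  "GL2H = \<lparr>carrier = {A. qdet A \<noteq> 0}, mult = (**), one = mat 1\<rparr>"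

definition SL2H :: "qmat2 monoid" where
  "SL2H = GL2H\<lparr>carrier := {A \<in> carrier GL2H. qdet A = 1}\<rparr>"

definition matK :: qmat2 where
  "matK = vector [vector [0, 1], vector [1, 0]]"

definition matH :: qmat2 where
  "matH = vector [vector [1, 0], vector [0, - 1]]"

definition SL_Hplus :: "qmat2 set" where
  "SL_Hplus = {A \<in> carrier GL2H. conj_transpose A ** matK ** A = matK}"

definition Sp11 :: "qmat2 set" where
  "Sp11 = {A \<in> carrier GL2H. conj_transpose A ** matH ** A = matH}"

end

theory Submission
  imports Defs
begin

text \<open>
  Both groups are isometry groups \<open>isometries M = {A. A\<^sup>* M A = M}\<close> of a nondegenerate form, where
  \<open>A\<^sup>*\<close> is the conjugate transpose.

  Why they lie in \<open>SL(2,\<H>)\<close>: the determinant is multiplicative, nonnegative and invariant under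
  \<open>\<^sup>*\<close>, so \<open>A\<^sup>* M A = M\<close> with \<open>det M \<noteq> 0\<close> forces \<open>(det A)\<^sup>2 = 1\<close>, hence \<open>det A = 1\<close>.
  Why they are isomorphic: the forms \<open>K\<close> and \<open>H\<close> are congruent. The real symmetric involution
  \<open>C = (1/\<surd>2) [[1, 1], [1, -1]]\<close> satisfies \<open>C K C = H\<close>, so \<open>A \<mapsto> C A C\<close> carries the isometries of
  \<open>K\<close> onto those of \<open>H\<close>.

  The substance is the multiplicativity of the determinant over a skew field. The radicand
  \<open>qdet_sq\<close> is multiplicative under right multiplication by shears, diagonal matrices
  and the coordinate swap (lemmas \<open>right_multiplicative_shear\<close>, \<open>right_multiplicative_diag\<close> and
  \<open>right_multiplicative_swap\<close>). Gaussian elimination writes every matrix as a product of these, and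
  the set of right factors with this property is closed under products.
  Inverses of matrices of determinant one come from a quaternionic adjugate \<open>qadj\<close>.
\<close>

section \<open>Quaternion conjugation\<close>

lemma qcnj_sel [simp]:
  "qRe (qcnj x) = qRe x" "qI (qcnj x) = - qI x" "qJ (qcnj x) = - qJ x" "qK (qcnj x) = - qK x"
  by (simp_all add: qcnj_def)

lemma qcnj_simps [simp]:
  "qcnj 0 = 0" "qcnj 1 = 1" "qcnj (- x) = - qcnj x" "qcnj (qcnj x) = x"
  "qcnj (x + y) = qcnj x + qcnj y" "qcnj (x * y) = qcnj y * qcnj x"
  "qcnj (scaleR r x) = scaleR r (qcnj x)" "norm (qcnj x) = norm x"
  by (simp_all add: quat_eq_iff norm_quat_def algebra_simps)

lemma norm_sq_quat: "(norm x)\<^sup>2 = (qRe x)\<^sup>2 + (qI x)\<^sup>2 + (qJ x)\<^sup>2 + (qK x)\<^sup>2" for x :: quat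
  by (simp add: norm_quat_def)

lemma qRe_mult_commute: "qRe (x * y) = qRe (y * x)"
  by simp

lemma qRe_qcnj: "qRe (qcnj x) = qRe x"
  by simp

lemma abs_qRe_le_norm: "\<bar>qRe x\<bar> \<le> norm x"
  unfolding norm_quat_def by (rule real_le_rsqrt) simp

lemma norm_sq_add_quat: "(norm (x + y))\<^sup>2 = (norm x)\<^sup>2 + (norm y)\<^sup>2 + 2 * qRe (x * qcnj y)"
  for x y :: quat
  unfolding norm_sq_quat by (simp add: power2_eq_square algebra_simps)

text \<open>
  The product of \<open>p\<close> and its conjugate is real and therefore central. Written as a scalar it can be
  pulled out of any word, and this is how the noncommutative expansions below are collected.
\<close>

lemma qcnj_collapse:
  "qcnj p * p = (norm p)\<^sup>2 *\<^sub>R 1" "p * qcnj p = (norm p)\<^sup>2 *\<^sub>R 1"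
  "qcnj p * (p * y) = (norm p)\<^sup>2 *\<^sub>R y" "p * (qcnj p * y) = (norm p)\<^sup>2 *\<^sub>R y"
proof -
  show self: "qcnj p * p = (norm p)\<^sup>2 *\<^sub>R 1" "p * qcnj p = (norm p)\<^sup>2 *\<^sub>R 1"
    unfolding norm_sq_quat by (simp_all add: quat_eq_iff power2_eq_square algebra_simps)
  show "qcnj p * (p * y) = (norm p)\<^sup>2 *\<^sub>R y" "p * (qcnj p * y) = (norm p)\<^sup>2 *\<^sub>R y"
    by (simp_all add: self flip: mult.assoc)
qed

lemmas qcnj_collapse_simps =
  qcnj_collapse mult_scaleR_left mult_scaleR_right scaleR_scaleR quat_scaleR_sel
  mult.assoc mult_1_left mult_1_right

section \<open>Two-by-two quaternionic matrices\<close>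

definition qmat :: "quat \<Rightarrow> quat \<Rightarrow> quat \<Rightarrow> quat \<Rightarrow> qmat2" where
  "qmat a b c d = vector [vector [a, b], vector [c, d]]"

lemma qmat_nth [simp]:
  "qmat a b c d $ 1 $ 1 = a" "qmat a b c d $ 1 $ 2 = b"
  "qmat a b c d $ 2 $ 1 = c" "qmat a b c d $ 2 $ 2 = d"
  by (simp_all add: qmat_def)

lemma qmat_eq_iff:
  "A = B \<longleftrightarrow> A $ 1 $ 1 = B $ 1 $ 1 \<and> A $ 1 $ 2 = B $ 1 $ 2 \<and> A $ 2 $ 1 = B $ 2 $ 1 \<and> A $ 2 $ 2 = B $ 2 $ 2"
  for A B :: qmat2
  by (simp add: vec_eq_iff forall_2)

lemma qmat_cases: obtains a b c d where "A = qmat a b c d"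
  by (rule that[of "A $ 1 $ 1" "A $ 1 $ 2" "A $ 2 $ 1" "A $ 2 $ 2"]) (simp add: qmat_eq_iff)

lemma qmat_mult:
  "qmat a b c d ** qmat a' b' c' d' =
   qmat (a * a' + b * c') (a * b' + b * d') (c * a' + d * c') (c * b' + d * d')"
  by (simp add: qmat_eq_iff matrix_matrix_mult_def sum_2)

lemma mat_1_qmat: "mat 1 = qmat 1 0 0 1"
  by (simp add: qmat_eq_iff mat_def)

lemma conj_transpose_qmat:
  "conj_transpose (qmat a b c d) = qmat (qcnj a) (qcnj c) (qcnj b) (qcnj d)"
  by (simp add: qmat_eq_iff conj_transpose_def transpose_def map_matrix_def)

lemma conj_transpose_mult: "conj_transpose (A ** B) = conj_transpose B ** conj_transpose A"
  by (cases A rule: qmat_cases; cases B rule: qmat_cases)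
    (simp add: conj_transpose_qmat qmat_mult)

lemma conj_transpose_mat_1 [simp]: "conj_transpose (mat 1) = mat 1"
  by (simp add: mat_1_qmat conj_transpose_qmat)

lemma matH_qmat: "matH = qmat 1 0 0 (- 1)" and matK_qmat: "matK = qmat 0 1 1 0"
  by (simp_all add: matH_def matK_def qmat_def)

section \<open>Multiplicativity of the determinant\<close>

definition qdet_sq :: "qmat2 \<Rightarrow> real" where
  "qdet_sq A =
    (norm (A $ 1 $ 1))\<^sup>2 * (norm (A $ 2 $ 2))\<^sup>2 + (norm (A $ 2 $ 1))\<^sup>2 * (norm (A $ 1 $ 2))\<^sup>2
    - 2 * qRe (A $ 2 $ 1 * qcnj (A $ 1 $ 1) * A $ 1 $ 2 * qcnj (A $ 2 $ 2))"

lemma qdet_sqrt: "qdet A = sqrt (qdet_sq A)"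
  by (simp add: qdet_def qdet_sq_def Let_def)

lemma qdet_sq_qmat:
  "qdet_sq (qmat a b c d) =
   (norm a)\<^sup>2 * (norm d)\<^sup>2 + (norm c)\<^sup>2 * (norm b)\<^sup>2 - 2 * qRe (c * qcnj a * b * qcnj d)"
  by (simp add: qdet_sq_def)

text \<open>
  Bounding the real part by the norm leaves the square of \<open>\<bar>a\<bar> \<bar>d\<bar> - \<bar>b\<bar> \<bar>c\<bar>\<close>.
\<close>

lemma qdet_sq_nonneg: "0 \<le> qdet_sq A"
proof (cases A rule: qmat_cases)
  case (1 a b c d)
  have "qRe (c * qcnj a * b * qcnj d) \<le> norm (c * qcnj a * b * qcnj d)"
    using abs_qRe_le_norm abs_le_D1 by blast
  also have "\<dots> = norm c * norm a * norm b * norm d"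
    by (simp add: norm_mult)
  finally have "(norm a * norm d - norm c * norm b)\<^sup>2 \<le> qdet_sq A"
    by (simp add: 1 qdet_sq_qmat power2_diff power_mult_distrib algebra_simps)
  then show ?thesis
    using zero_le_power2 order_trans by blast
qed

text \<open>
  The conjugate transpose replaces the word \<open>c a\<^sup>* b d\<^sup>*\<close> by the conjugate of a cyclic rotation of
  it, which has the same real part.
\<close>

lemma qdet_sq_conj_transpose: "qdet_sq (conj_transpose A) = qdet_sq A"
proof (cases A rule: qmat_cases)
  case (1 a b c d)
  have "qRe (qcnj b * a * qcnj c * d) = qRe (qcnj (qcnj d * (c * qcnj a * b)))"
    by (simp only: qcnj_simps mult.assoc)
  also have "\<dots> = qRe (c * qcnj a * b * qcnj d)"
    by (metis qRe_mult_commute qRe_qcnj)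
  finally show ?thesis
    by (simp only: 1 conj_transpose_qmat qdet_sq_qmat qcnj_simps) simp
qed

definition right_multiplicative :: "qmat2 \<Rightarrow> bool" where
  "right_multiplicative B \<longleftrightarrow> (\<forall>A. qdet_sq (A ** B) = qdet_sq A * qdet_sq B)"

lemma right_multiplicative_mult:
  assumes "right_multiplicative B" "right_multiplicative C"
  shows "right_multiplicative (B ** C)"
  using assms by (simp add: right_multiplicative_def matrix_mul_assoc)

lemma right_multiplicativeI:
  assumes "\<And>a b c d. qdet_sq (qmat a b c d ** B) = qdet_sq (qmat a b c d) * qdet_sq B"
  shows "right_multiplicative B"
  unfolding right_multiplicative_def
proof
  fix A
  show "qdet_sq (A ** B) = qdet_sq A * qdet_sq B"
    by (cases A rule: qmat_cases) (simp only: assms)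
qed

lemma right_multiplicative_diag: "right_multiplicative (qmat p 0 0 q)"
proof (rule right_multiplicativeI)
  fix a b c d
  have "qRe ((c * p) * qcnj (a * p) * (b * q) * qcnj (d * q)) =
        (norm q)\<^sup>2 * ((norm p)\<^sup>2 * qRe (c * qcnj a * b * qcnj d))"
    by (simp only: qcnj_simps qcnj_collapse_simps ac_simps)
  then show "qdet_sq (qmat a b c d ** qmat p 0 0 q) =
      qdet_sq (qmat a b c d) * qdet_sq (qmat p 0 0 q)"
    by (simp add: qmat_mult qdet_sq_qmat norm_mult power_mult_distrib algebra_simps
        del: quat_mult_sel qcnj_simps(6))
qed

lemma right_multiplicative_swap: "right_multiplicative (qmat 0 1 1 0)"
proof (rule right_multiplicativeI)
  fix a b c d
  have "qRe (d * qcnj b * a * qcnj c) = qRe (qcnj (c * qcnj a * b * qcnj d))"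
    by (simp only: qcnj_simps mult.assoc)
  also have "\<dots> = qRe (c * qcnj a * b * qcnj d)"
    by (rule qRe_qcnj)
  finally show "qdet_sq (qmat a b c d ** qmat 0 1 1 0) =
      qdet_sq (qmat a b c d) * qdet_sq (qmat 0 1 1 0)"
    by (simp add: qmat_mult qdet_sq_qmat del: quat_mult_sel)
qed

text \<open>
  Adding a right multiple of the first column to the second changes nothing: in the expansion the
  terms quadratic in \<open>x\<close> cancel, and so do the linear ones \<open>\<bar>a\<bar>\<^sup>2 Re (c x d\<^sup>*)\<close> and
  \<open>\<bar>c\<bar>\<^sup>2 Re (a x b\<^sup>*)\<close>.
\<close>

lemma right_multiplicative_shear: "right_multiplicative (qmat 1 x 0 1)"
proof (rule right_multiplicativeI)
  fix a b c d
  have "c * qcnj a * (a * x + b) * qcnj (c * x + d) =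
      c * qcnj a * (a * x) * qcnj (c * x) + c * qcnj a * (a * x) * qcnj d
      + c * qcnj a * b * qcnj (c * x) + c * qcnj a * b * qcnj d"
    by (simp add: distrib_left distrib_right mult.assoc)
  moreover have "qRe (c * qcnj a * (a * x) * qcnj (c * x)) = (norm a)\<^sup>2 * (norm c)\<^sup>2 * (norm x)\<^sup>2"
    by (simp only: qcnj_simps qcnj_collapse_simps quat_one_sel ac_simps)
  moreover have "qRe (c * qcnj a * (a * x) * qcnj d) = (norm a)\<^sup>2 * qRe ((c * x) * qcnj d)"
    by (simp only: qcnj_collapse_simps)
  moreover have "qRe (c * qcnj a * b * qcnj (c * x)) = (norm c)\<^sup>2 * qRe ((a * x) * qcnj b)"
  proof -
    have "qRe (c * qcnj a * b * qcnj (c * x)) = qRe (qcnj c * (c * (qcnj a * b * qcnj x)))"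
      by (simp only: qcnj_simps mult.assoc)
        (metis qRe_mult_commute mult.assoc)
    also have "\<dots> = (norm c)\<^sup>2 * qRe (qcnj a * (b * qcnj x))"
      by (simp only: qcnj_collapse_simps)
    also have "qRe (qcnj a * (b * qcnj x)) = qRe (qcnj ((a * x) * qcnj b))"
      by (simp add: algebra_simps)
    finally show ?thesis
      by (simp only: qRe_qcnj)
  qed
  ultimately show "qdet_sq (qmat a b c d ** qmat 1 x 0 1) =
      qdet_sq (qmat a b c d) * qdet_sq (qmat 1 x 0 1)"
    by (simp only: qmat_mult qdet_sq_qmat mult_1_right mult_zero_right add_0_right
          norm_sq_add_quat norm_mult power_mult_distrib quat_plus_sel)
      (simp add: algebra_simps del: quat_mult_sel qcnj_simps(6))
qed

text \<open>
  A lower shear is the upper shear conjugated by the swap.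
\<close>

lemma right_multiplicative_lower_shear: "right_multiplicative (qmat 1 0 x 1)"
proof -
  have "qmat 1 0 x 1 = qmat 0 1 1 0 ** (qmat 1 x 0 1 ** qmat 0 1 1 0)"
    by (simp add: qmat_mult)
  then show ?thesis
    by (simp add: right_multiplicative_mult right_multiplicative_swap right_multiplicative_shear)
qed

text \<open>
  A nonzero corner entry is a pivot: the matrix is lower shear, diagonal, upper shear, with the Schur
  complement \<open>d - c a\<^sup>-\<^sup>1 b\<close> on the diagonal.
\<close>

lemma right_multiplicative_pivot:
  assumes "a \<noteq> 0"
  shows "right_multiplicative (qmat a b c d)"
proof -
  have "qmat a b c d =
      qmat 1 0 (c * inverse a) 1 ** (qmat a 0 0 (d - c * inverse a * b) ** qmat 1 (inverse a * b) 0 1)"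
    using assms by (simp add: qmat_mult mult.assoc flip: mult.assoc[of a] mult.assoc[of "inverse a" a])
  then show ?thesis
    by (simp add: right_multiplicative_mult right_multiplicative_diag right_multiplicative_shear
        right_multiplicative_lower_shear)
qed

text \<open>
  If the corner vanishes, swapping columns or rows brings a nonzero entry there, unless the matrix is
  diagonal.
\<close>

lemma right_multiplicative: "right_multiplicative B"
proof (cases B rule: qmat_cases)
  case (1 a b c d)
  consider "a \<noteq> 0" | "b \<noteq> 0" | "c \<noteq> 0" | "b = 0" "c = 0"
    by blast
  then show ?thesis
  proof cases
    case 2
    have "B = qmat b a d c ** qmat 0 1 1 0"
      by (simp add: 1 qmat_mult)
    with 2 show ?thesis
      by (simp add: right_multiplicative_mult right_multiplicative_swap right_multiplicative_pivot)
  next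
    case 3
    have "B = qmat 0 1 1 0 ** qmat c d a b"
      by (simp add: 1 qmat_mult)
    with 3 show ?thesis
      by (simp add: right_multiplicative_mult right_multiplicative_swap right_multiplicative_pivot)
  qed (simp_all add: 1 right_multiplicative_pivot right_multiplicative_diag)
qed

lemma qdet_sq_mult: "qdet_sq (A ** B) = qdet_sq A * qdet_sq B"
  using right_multiplicative by (simp add: right_multiplicative_def)

lemma qdet_mult: "qdet (A ** B) = qdet A * qdet B"
  by (simp add: qdet_sqrt qdet_sq_mult real_sqrt_mult)

lemma qdet_nonneg: "0 \<le> qdet A"
  by (simp add: qdet_sqrt qdet_sq_nonneg)

lemma qdet_conj_transpose: "qdet (conj_transpose A) = qdet A"
  by (simp add: qdet_sqrt qdet_sq_conj_transpose)

lemma qdet_mat_1 [simp]: "qdet (mat 1) = 1"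
  by (simp add: mat_1_qmat qdet_sqrt qdet_sq_qmat)

section \<open>The special linear group\<close>

text \<open>
  The adjugate: over commuting entries it is the classical adjugate times the conjugate of the
  classical determinant, so that its product with the matrix is the squared modulus of the determinant.
\<close>

definition qadj :: "qmat2 \<Rightarrow> qmat2" where
  "qadj A = (let a = A $ 1 $ 1; b = A $ 1 $ 2; c = A $ 2 $ 1; d = A $ 2 $ 2
    in qmat (qcnj a * d * qcnj d - qcnj c * d * qcnj b) (qcnj c * b * qcnj b - qcnj a * b * qcnj d)
            (qcnj b * c * qcnj c - qcnj d * c * qcnj a) (qcnj d * a * qcnj a - qcnj b * a * qcnj c))"

lemma add_qcnj: "x + qcnj x = (2 * qRe x) *\<^sub>R 1"
  by (simp add: quat_eq_iff)

text \<open>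
  On the diagonal two words collapse to norms, and the other two are conjugate to each other, so that
  their sum is the real part in the determinant. Off the diagonal the words cancel in pairs.
\<close>

lemma qadj_mult_left: "qadj A ** A = qmat (qdet_sq A *\<^sub>R 1) 0 0 (qdet_sq A *\<^sub>R 1)"
proof (cases A rule: qmat_cases)
  case (1 a b c d)
  let ?w = "qcnj a * b * qcnj d * c" and ?v = "qcnj d * c * qcnj a * b"
  have re: "qRe ?w = qRe (c * qcnj a * b * qcnj d)" "qRe ?v = qRe (c * qcnj a * b * qcnj d)"
    by (simp_all only: mult.assoc) (metis qRe_mult_commute mult.assoc)+
  have "(qcnj a * d * qcnj d - qcnj c * d * qcnj b) * a + (qcnj c * b * qcnj b - qcnj a * b * qcnj d) * c
      = ((norm a)\<^sup>2 * (norm d)\<^sup>2 + (norm c)\<^sup>2 * (norm b)\<^sup>2) *\<^sub>R 1 - (?w + qcnj ?w)"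
    by (simp only: left_diff_distrib qcnj_simps qcnj_collapse_simps scaleR_left_distrib)
      (simp add: algebra_simps del: quat_mult_sel)
  moreover
  have "(qcnj b * c * qcnj c - qcnj d * c * qcnj a) * b + (qcnj d * a * qcnj a - qcnj b * a * qcnj c) * d
      = ((norm a)\<^sup>2 * (norm d)\<^sup>2 + (norm c)\<^sup>2 * (norm b)\<^sup>2) *\<^sub>R 1 - (?v + qcnj ?v)"
    by (simp only: left_diff_distrib qcnj_simps qcnj_collapse_simps scaleR_left_distrib)
      (simp add: algebra_simps del: quat_mult_sel)
  moreover
  have "(qcnj a * d * qcnj d - qcnj c * d * qcnj b) * b + (qcnj c * b * qcnj b - qcnj a * b * qcnj d) * d = 0"
    "(qcnj b * c * qcnj c - qcnj d * c * qcnj a) * a + (qcnj d * a * qcnj a - qcnj b * a * qcnj c) * c = 0"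
    by (simp_all add: left_diff_distrib qcnj_collapse mult.assoc del: quat_mult_sel)
  ultimately show ?thesis
    by (simp only: 1 qadj_def Let_def qmat_nth qmat_mult qdet_sq_qmat add_qcnj re scaleR_left_diff_distrib)
qed

lemma SL2H_simps [simp]:
  "carrier SL2H = {A. qdet A = 1}" "mult SL2H = (**)" "one SL2H = mat 1"
  by (auto simp: SL2H_def GL2H_def)

lemma group_SL2H: "group SL2H"
proof (rule groupI)
  fix A assume "A \<in> carrier SL2H"
  then have A: "qdet A = 1" by simp
  then have inv: "qadj A ** A = mat 1"
    by (simp add: qadj_mult_left mat_1_qmat qdet_sqrt)
  then have "qdet (qadj A) = 1"
    using A qdet_mult[of "qadj A" A] by simp
  with inv show "\<exists>B\<in>carrier SL2H. B \<otimes>\<^bsub>SL2H\<^esub> A = \<one>\<^bsub>SL2H\<^esub>"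
    by auto
qed (simp_all add: qdet_mult matrix_mul_assoc)

section \<open>Isometry groups of forms\<close>

definition isometries :: "qmat2 \<Rightarrow> qmat2 set" where
  "isometries M = {A. conj_transpose A ** M ** A = M}"

lemma qdet_isometry:
  assumes "qdet M \<noteq> 0" "A \<in> isometries M"
  shows "qdet A = 1"
proof -
  have "qdet (conj_transpose A ** M ** A) = qdet M"
    using assms(2) by (simp add: isometries_def)
  then have "(qdet A)\<^sup>2 = 1"
    using assms(1) by (simp add: qdet_mult qdet_conj_transpose power2_eq_square)
  then show ?thesis
    using qdet_nonneg[of A] by (simp add: power2_eq_1_iff)
qed

lemma subgroup_isometries:
  assumes "qdet M \<noteq> 0"
  shows "subgroup (isometries M) SL2H"
proof (rule group.subgroupI[OF group_SL2H])
  show "isometries M \<subseteq> carrier SL2H"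
    using qdet_isometry[OF assms] by auto
  have "mat 1 \<in> isometries M"
    by (simp add: isometries_def)
  then show "isometries M \<noteq> {}"
    by blast
next
  fix A assume A: "A \<in> isometries M"
  then have "A \<in> carrier SL2H"
    using qdet_isometry[OF assms] by simp
  then have "A ** inv\<^bsub>SL2H\<^esub> A = mat 1"
    using group.r_inv[OF group_SL2H] by simp
  moreover define B where "B = inv\<^bsub>SL2H\<^esub> A"
  ultimately have AB: "A ** B = mat 1"
    by simp
  have "conj_transpose B ** M ** B = conj_transpose B ** (conj_transpose A ** M ** A) ** B"
    using A by (simp add: isometries_def)
  also have "\<dots> = conj_transpose (A ** B) ** M ** (A ** B)"
    by (simp add: conj_transpose_mult matrix_mul_assoc)
  finally show "inv\<^bsub>SL2H\<^esub> A \<in> isometries M"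
    by (simp add: AB isometries_def flip: B_def)
next
  fix A B assume AB: "A \<in> isometries M" "B \<in> isometries M"
  have "conj_transpose (A ** B) ** M ** (A ** B) =
      conj_transpose B ** (conj_transpose A ** M ** A) ** B"
    by (simp add: conj_transpose_mult matrix_mul_assoc)
  with AB show "A \<otimes>\<^bsub>SL2H\<^esub> B \<in> isometries M"
    by (simp add: isometries_def)
qed

lemma conjugate_isometry:
  assumes "C ** C = mat 1" "conj_transpose C = C" "A \<in> isometries M"
  shows "C ** A ** C \<in> isometries (C ** M ** C)"
proof -
  have cancel: "X ** C ** C = X" for X
    using assms(1) by (simp flip: matrix_mul_assoc)
  have "conj_transpose (C ** A ** C) ** (C ** M ** C) ** (C ** A ** C) =
      C ** (conj_transpose A ** M ** A) ** C"
    by (simp add: conj_transpose_mult assms(2) matrix_mul_assoc cancel)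
  with assms(3) show ?thesis
    by (simp add: isometries_def)
qed

text \<open>
  Conjugation by an involution is its own inverse, so it is enough to know that it maps the isometries
  of each form to those of the other.
\<close>

lemma isometries_iso:
  assumes C: "C ** C = mat 1" "conj_transpose C = C" and N: "C ** M ** C = N"
  shows "SL2H\<lparr>carrier := isometries M\<rparr> \<cong> SL2H\<lparr>carrier := isometries N\<rparr>"
proof -
  have cancel: "X ** C ** C = X" for X
    using C(1) by (simp flip: matrix_mul_assoc)
  have involution: "C ** (C ** X ** C) ** C = X" for X
    by (simp add: matrix_mul_assoc cancel C(1))
  have M: "C ** N ** C = M"
    using N involution by blast
  have "bij_betw (\<lambda>A. C ** A ** C) (isometries M) (isometries N)"
    by (rule bij_betw_byWitness[where f' = "\<lambda>A. C ** A ** C"])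
      (use conjugate_isometry[OF C] N M in \<open>force simp: involution\<close>)+
  moreover have "(\<lambda>A. C ** A ** C) \<in>
      hom (SL2H\<lparr>carrier := isometries M\<rparr>) (SL2H\<lparr>carrier := isometries N\<rparr>)"
    using conjugate_isometry[OF C, of _ M] N
    by (auto simp: hom_def matrix_mul_assoc cancel)
  ultimately show ?thesis
    by (auto simp: is_iso_def iso_def)
qed

lemma SL_Hplus_isometries: "SL_Hplus = isometries matK"
  and Sp11_isometries: "Sp11 = isometries matH"
  and qdet_matK: "qdet matK \<noteq> 0" and qdet_matH: "qdet matH \<noteq> 0"
proof -
  show K: "qdet matK \<noteq> 0" and H: "qdet matH \<noteq> 0"
    by (simp_all add: matK_qmat matH_qmat qdet_sqrt qdet_sq_qmat)
  show "SL_Hplus = isometries matK" "Sp11 = isometries matH"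
    using qdet_isometry[OF K] qdet_isometry[OF H]
    by (force simp: SL_Hplus_def Sp11_def GL2H_def isometries_def)+
qed

theorem theorem1p13:
  shows "group SL2H \<and> subgroup SL_Hplus SL2H \<and> subgroup Sp11 SL2H \<and>
    SL2H\<lparr>carrier := SL_Hplus\<rparr> \<cong> SL2H\<lparr>carrier := Sp11\<rparr>"
proof -
  define s :: quat where "s = of_real (1 / sqrt 2)"
  define C where "C = qmat s s s (- s)"
  have half: "s * s = of_real (1 / 2)"
    by (simp only: s_def flip: of_real_mult) simp
  have double: "s * s + s * s = 1"
    by (simp only: half flip: of_real_add) simp
  then have double_neg: "- (s * s) - s * s = - 1"
    by (metis diff_conv_add_uminus minus_add_distrib)
  have "qcnj s = s"
    by (simp add: s_def of_real_def quat_eq_iff)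
  then have "conj_transpose C = C" "C ** C = mat 1" "C ** matK ** C = matH"
    by (simp_all add: C_def conj_transpose_qmat qmat_mult mat_1_qmat matK_qmat matH_qmat double double_neg)
  then have "SL2H\<lparr>carrier := isometries matK\<rparr> \<cong> SL2H\<lparr>carrier := isometries matH\<rparr>"
    by (intro isometries_iso)
  then show ?thesis
    using group_SL2H subgroup_isometries[OF qdet_matK] subgroup_isometries[OF qdet_matH]
    by (simp add: SL_Hplus_isometries Sp11_isometries)
qed

end
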